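(* Let $\mathbf{H}$ be a bounded hoop. Then the double negation mapping $\delta:H\to H$, $\delta(x)=\neg\neg x$, is a homomorphism $\mathbf{H}\to\mathbf{H}$ of bounded hoops. Moreover, if $p:\mathbf{H}\to\mathsf{IR}(\mathbf{H})$ is the natural projection onto the involutive replica of $\mathbf{H}$, then $p$ factors as $p=i\circ\delta$ where $i:\mathrm{im}(\delta)\to\mathsf{IR}(\mathbf{H})$ is an isomorphism.
   Context: A pocrim is a structure $\mathbf{P}=(P;0,+,\rightarrow)$ such that, writing $x\ge y$ for $x\rightarrow y=0$: $(P;0,+)$ is a commutative monoid; $\ge$ is a partial order on $P$; $x\ge y$ implies $x+z\ge y+z$; $x\ge 0$ for all $x$; and $x+y\ge z$ iff $x\ge y\rightarrow z$. A hoop is a pocrim satisfying $x+(x\rightarrow y)=y+(y\rightarrow x)$. A pocrim is bounded if it has an element $1$ with $x+1=1$ for all $x$; then $\neg x$ denotes $x\rightarrow 1$. For bounded hoops, $1$ is a constant of the signature, so homomorphisms preserve $0,1,+,\rightarrow$. A bounded pocrim is involutive if $\neg\neg x=x$ for all $x$. The involutive replica $\mathsf{IR}(\mathbf{H})$ of a bounded hoop $\mathbf{H}$ is the quotient $\mathbf{H}/\theta$, where $\theta$ is the smallest congruence on $\mathbf{H}$ such that $x\mathrel{\theta}\delta(x)$ for all $x\in H$. The image $\mathrm{im}(\delta)=\{\delta(x)\mid x\in H\}$ is regarded as a bounded subhoop of $\mathbf{H}$. *)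

theory Defs
  imports "HOL-Algebra.Congruence"
begin

record 'a pocrim = "'a partial_object" +
  zero :: 'a (\<open>\<zero>\<index>\<close>)
  add :: "'a \<Rightarrow> 'a \<Rightarrow> 'a" (infixl \<open>\<oplus>\<index>\<close> 65)
  imp :: "'a \<Rightarrow> 'a \<Rightarrow> 'a" (infixr \<open>\<leadsto>\<index>\<close> 60)

record 'a bounded_pocrim = "'a pocrim" +
  one :: 'a (\<open>\<one>\<index>\<close>)

definition pocrim_ge :: "('a, 'b) pocrim_scheme \<Rightarrow> 'a \<Rightarrow> 'a \<Rightarrow> bool" (infix \<open>\<succeq>\<index>\<close> 50)
  where "x \<succeq>\<^bsub>P\<^esub> y \<longleftrightarrow> x \<leadsto>\<^bsub>P\<^esub> y = \<zero>\<^bsub>P\<^esub>"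

locale pocrim =
  fixes P (structure)
  assumes zero_closed: "\<zero> \<in> carrier P"
    and add_closed: "\<lbrakk>x \<in> carrier P; y \<in> carrier P\<rbrakk> \<Longrightarrow> x \<oplus> y \<in> carrier P"
    and imp_closed: "\<lbrakk>x \<in> carrier P; y \<in> carrier P\<rbrakk> \<Longrightarrow> x \<leadsto> y \<in> carrier P"
    and add_assoc: "\<lbrakk>x \<in> carrier P; y \<in> carrier P; z \<in> carrier P\<rbrakk>
      \<Longrightarrow> (x \<oplus> y) \<oplus> z = x \<oplus> (y \<oplus> z)"
    and add_comm: "\<lbrakk>x \<in> carrier P; y \<in> carrier P\<rbrakk> \<Longrightarrow> x \<oplus> y = y \<oplus> x"
    and add_zero: "x \<in> carrier P \<Longrightarrow> x \<oplus> \<zero> = x"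
    and ge_refl: "x \<in> carrier P \<Longrightarrow> x \<succeq> x"
    and ge_antisym: "\<lbrakk>x \<in> carrier P; y \<in> carrier P; x \<succeq> y; y \<succeq> x\<rbrakk> \<Longrightarrow> x = y"
    and ge_trans: "\<lbrakk>x \<in> carrier P; y \<in> carrier P; z \<in> carrier P; x \<succeq> y; y \<succeq> z\<rbrakk> \<Longrightarrow> x \<succeq> z"
    and add_mono: "\<lbrakk>x \<in> carrier P; y \<in> carrier P; z \<in> carrier P; x \<succeq> y\<rbrakk> \<Longrightarrow> x \<oplus> z \<succeq> y \<oplus> z"
    and ge_zero: "x \<in> carrier P \<Longrightarrow> x \<succeq> \<zero>"
    and residuation: "\<lbrakk>x \<in> carrier P; y \<in> carrier P; z \<in> carrier P\<rbrakk>
      \<Longrightarrow> x \<oplus> y \<succeq> z \<longleftrightarrow> x \<succeq> y \<leadsto> z"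

locale hoop = pocrim +
  assumes divisibility: "\<lbrakk>x \<in> carrier P; y \<in> carrier P\<rbrakk>
    \<Longrightarrow> x \<oplus> (x \<leadsto> y) = y \<oplus> (y \<leadsto> x)"

locale bounded_hoop = hoop P for P :: "('a, 'b) bounded_pocrim_scheme" (structure) +
  assumes one_closed: "\<one> \<in> carrier P"
    and add_one: "x \<in> carrier P \<Longrightarrow> x \<oplus> \<one> = \<one>"

definition neg :: "('a, 'b) bounded_pocrim_scheme \<Rightarrow> 'a \<Rightarrow> 'a"
  where "neg P x = x \<leadsto>\<^bsub>P\<^esub> \<one>\<^bsub>P\<^esub>"

definition dneg :: "('a, 'b) bounded_pocrim_scheme \<Rightarrow> 'a \<Rightarrow> 'a"
  where "dneg P x = neg P (neg P x)"

locale bounded_hoop_hom = source: bounded_hoop A + target: bounded_hoop B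
  for A :: "('a, 'c) bounded_pocrim_scheme" and B :: "('b, 'd) bounded_pocrim_scheme" +
  fixes h :: "'a \<Rightarrow> 'b"
  assumes hom_closed: "h \<in> carrier A \<rightarrow> carrier B"
    and hom_zero: "h \<zero>\<^bsub>A\<^esub> = \<zero>\<^bsub>B\<^esub>"
    and hom_one: "h \<one>\<^bsub>A\<^esub> = \<one>\<^bsub>B\<^esub>"
    and hom_add: "\<lbrakk>x \<in> carrier A; y \<in> carrier A\<rbrakk> \<Longrightarrow> h (x \<oplus>\<^bsub>A\<^esub> y) = h x \<oplus>\<^bsub>B\<^esub> h y"
    and hom_imp: "\<lbrakk>x \<in> carrier A; y \<in> carrier A\<rbrakk> \<Longrightarrow> h (x \<leadsto>\<^bsub>A\<^esub> y) = h x \<leadsto>\<^bsub>B\<^esub> h y"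

locale bounded_hoop_iso = bounded_hoop_hom +
  assumes bij: "bij_betw h (carrier A) (carrier B)"

definition congruence :: "('a, 'b) pocrim_scheme \<Rightarrow> 'a rel \<Rightarrow> bool"
  where "congruence P \<theta> \<longleftrightarrow> equiv (carrier P) \<theta> \<and>
    (\<forall>x x' y y'. (x, x') \<in> \<theta> \<longrightarrow> (y, y') \<in> \<theta> \<longrightarrow>
      (x \<oplus>\<^bsub>P\<^esub> y, x' \<oplus>\<^bsub>P\<^esub> y') \<in> \<theta> \<and> (x \<leadsto>\<^bsub>P\<^esub> y, x' \<leadsto>\<^bsub>P\<^esub> y') \<in> \<theta>)"

text \<open>When \<open>\<theta>\<close> is a congruence, each union below is a union of copies of a single class.\<close>

definition quotient_pocrim :: "'a bounded_pocrim \<Rightarrow> 'a rel \<Rightarrow> 'a set bounded_pocrim"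
  where "quotient_pocrim P \<theta> =
    \<lparr>carrier = carrier P // \<theta>,
     zero = \<theta> `` {\<zero>\<^bsub>P\<^esub>},
     add = (\<lambda>X Y. \<Union>x\<in>X. \<Union>y\<in>Y. \<theta> `` {x \<oplus>\<^bsub>P\<^esub> y}),
     imp = (\<lambda>X Y. \<Union>x\<in>X. \<Union>y\<in>Y. \<theta> `` {x \<leadsto>\<^bsub>P\<^esub> y}),
     one = \<theta> `` {\<one>\<^bsub>P\<^esub>}\<rparr>"

definition inv_cong :: "('a, 'b) bounded_pocrim_scheme \<Rightarrow> 'a rel"
  where "inv_cong H = \<Inter>{\<theta>. congruence H \<theta> \<and> (\<forall>x\<in>carrier H. (x, dneg H x) \<in> \<theta>)}"

text \<open>The intersection is itself a congruence of the required kind, hence the smallest one.\<close>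

lemma (in bounded_hoop) inv_cong_smallest:
  shows "congruence P (inv_cong P)"
    and "\<forall>x\<in>carrier P. (x, dneg P x) \<in> inv_cong P"
    and "\<lbrakk>congruence P \<theta>; \<forall>x\<in>carrier P. (x, dneg P x) \<in> \<theta>\<rbrakk> \<Longrightarrow> inv_cong P \<subseteq> \<theta>"
proof -
  let ?S = "{\<theta>. congruence P \<theta> \<and> (\<forall>x\<in>carrier P. (x, dneg P x) \<in> \<theta>)}"
  have "carrier P \<times> carrier P \<in> ?S"
    by (auto simp: congruence_def equiv_def refl_on_def sym_def trans_def dneg_def neg_def
        add_closed imp_closed one_closed)
  then have sub: "\<Inter>?S \<subseteq> carrier P \<times> carrier P" by blast
  have eq: "\<And>\<theta>. \<theta> \<in> ?S \<Longrightarrow> refl_on (carrier P) \<theta> \<and> sym \<theta> \<and> trans \<theta>"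
    by (simp add: congruence_def equiv_def)
  have "equiv (carrier P) (\<Inter>?S)"
  proof (rule equivI[OF sub])
    show "refl_on (carrier P) (\<Inter>?S)" using eq unfolding refl_on_def by blast
    show "sym (\<Inter>?S)" using eq unfolding sym_def by blast
    show "trans (\<Inter>?S)" using eq unfolding trans_def by blast
  qed
  then show "congruence P (inv_cong P)"
    unfolding inv_cong_def congruence_def[of P "\<Inter>?S"] by (auto simp: congruence_def)
qed (auto simp: inv_cong_def)

definition IR :: "'a bounded_pocrim \<Rightarrow> 'a set bounded_pocrim"
  where "IR H = quotient_pocrim H (inv_cong H)"

definition IR_proj :: "'a bounded_pocrim \<Rightarrow> 'a \<Rightarrow> 'a set"
  where "IR_proj H x = inv_cong H `` {x}"

definition dneg_image :: "'a bounded_pocrim \<Rightarrow> 'a bounded_pocrim"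
  where "dneg_image H = H\<lparr>carrier := dneg H ` carrier H\<rparr>"

end

theory Submission
  imports Defs
begin

text \<open>The order \<open>\<succeq>\<close> is the reverse of the usual order of residuated structures: \<open>\<oplus>\<close> plays the
  role of the monoidal conjunction, \<open>\<zero>\<close> is truth and \<open>\<one>\<close> is falsity. Call \<open>d\<close> dense when \<open>\<not>d = \<one>\<close>.
  If \<open>d\<close> is dense and \<open>\<not>x \<succeq> d\<close>, divisibility gives \<open>d \<oplus> \<not>x = \<not>x\<close>. The element
  \<open>\<not>\<not>x \<leadsto> x\<close> is dense, which yields compatibility of \<open>\<not>\<not>\<close> with \<open>\<leadsto>\<close>. For \<open>r = \<not>\<not>(\<not>\<not>x \<oplus> \<not>\<not>y)\<close>,
  the element \<open>r \<leadsto> \<not>\<not>x \<oplus> \<not>\<not>y\<close> is therefore dense, and \<open>r\<close> dominates it because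
  \<open>r \<oplus> r \<succeq> \<not>\<not>x \<oplus> \<not>\<not>y\<close>; absorption gives \<open>r = \<not>\<not>x \<oplus> \<not>\<not>y\<close>, which is compatibility with \<open>\<oplus>\<close>.
  Since \<open>\<not>\<not>\<close> is an idempotent endomorphism, its kernel is the smallest congruence relating each
  \<open>x\<close> to \<open>\<not>\<not>x\<close>.\<close>

section \<open>Order and residuation\<close>

context pocrim
begin

lemmas closed = zero_closed add_closed imp_closed

lemma ge_add_left:
  assumes "x \<in> carrier P" "y \<in> carrier P"
  shows "x \<oplus> y \<succeq> x"
  using add_mono[of y \<zero> x] ge_zero[of y] assms by (simp add: closed add_comm add_zero)

lemma ge_add_right:
  assumes "x \<in> carrier P" "y \<in> carrier P"
  shows "x \<oplus> y \<succeq> y"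
  using ge_add_left[of y x] assms by (simp add: add_comm)

lemma add_mono2:
  assumes "x \<in> carrier P" "y \<in> carrier P" "z \<in> carrier P" "w \<in> carrier P" "x \<succeq> z" "y \<succeq> w"
  shows "x \<oplus> y \<succeq> z \<oplus> w"
proof -
  have "x \<oplus> y \<succeq> z \<oplus> y" using assms add_mono by blast
  moreover have "z \<oplus> y \<succeq> z \<oplus> w"
    using add_mono[of y w z] assms by (simp add: add_comm)
  ultimately show ?thesis
    using ge_trans[of "x \<oplus> y" "z \<oplus> y" "z \<oplus> w"] assms by (simp add: closed)
qed

lemma imp_elim:
  assumes "x \<in> carrier P" "y \<in> carrier P"
  shows "(x \<leadsto> y) \<oplus> x \<succeq> y"
  using assms by (simp add: residuation closed ge_refl)

text \<open>By residuation and associativity, an element dominates one side exactly when it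
  dominates the other; testing this on the two sides themselves gives equality by
  antisymmetry.\<close>

lemma imp_curry:
  assumes "x \<in> carrier P" "y \<in> carrier P" "z \<in> carrier P"
  shows "(x \<oplus> y) \<leadsto> z = x \<leadsto> (y \<leadsto> z)"
proof -
  have "w \<succeq> (x \<oplus> y) \<leadsto> z \<longleftrightarrow> w \<succeq> x \<leadsto> (y \<leadsto> z)" if "w \<in> carrier P" for w
    using assms that by (simp add: residuation[symmetric] closed add_assoc)
  from this[of "(x \<oplus> y) \<leadsto> z"] this[of "x \<leadsto> (y \<leadsto> z)"] show ?thesis
    using assms by (intro ge_antisym) (auto simp: closed ge_refl)
qed

end

lemma (in hoop) add_imp_eq:
  assumes "x \<in> carrier P" "y \<in> carrier P" "x \<succeq> y"
  shows "y \<oplus> (y \<leadsto> x) = x"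
  using divisibility[of x y] assms by (simp add: pocrim_ge_def add_zero)

section \<open>Negation as an antitone Galois connection\<close>

context bounded_hoop
begin

lemma neg_closed: "x \<in> carrier P \<Longrightarrow> neg P x \<in> carrier P"
  by (simp add: neg_def closed one_closed)

lemma dneg_closed: "x \<in> carrier P \<Longrightarrow> dneg P x \<in> carrier P"
  by (simp add: dneg_def neg_closed)

lemmas bclosed = closed one_closed neg_closed dneg_closed

lemma one_ge: "x \<in> carrier P \<Longrightarrow> \<one> \<succeq> x"
  using ge_add_left[of x \<one>] by (simp add: add_one one_closed)

lemma ge_one_iff: "x \<in> carrier P \<Longrightarrow> x \<succeq> \<one> \<longleftrightarrow> x = \<one>"
  using ge_antisym[of x \<one>] one_ge[of x] ge_refl by (auto simp: bclosed)

lemma ge_neg_iff: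
  assumes "x \<in> carrier P" "y \<in> carrier P"
  shows "x \<succeq> neg P y \<longleftrightarrow> x \<oplus> y = \<one>"
  using assms by (simp add: neg_def residuation[symmetric] bclosed ge_one_iff)

lemma neg_add:
  assumes "x \<in> carrier P" "y \<in> carrier P"
  shows "neg P (x \<oplus> y) = x \<leadsto> neg P y"
  using assms by (simp add: neg_def imp_curry bclosed)

lemma neg_add_self: "x \<in> carrier P \<Longrightarrow> neg P x \<oplus> x = \<one>"
  using ge_neg_iff[of "neg P x" x] by (simp add: bclosed ge_refl)

lemma neg_one: "neg P \<one> = \<zero>"
  using ge_refl[of \<one>] by (simp add: neg_def pocrim_ge_def bclosed)

lemma neg_zero: "neg P \<zero> = \<one>"
  using neg_add_self[of \<zero>] by (simp add: bclosed add_zero)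

lemma ge_dneg: "x \<in> carrier P \<Longrightarrow> x \<succeq> dneg P x"
  using neg_add_self[of x] by (simp add: dneg_def ge_neg_iff bclosed add_comm)

lemma neg_antimono:
  assumes "x \<in> carrier P" "y \<in> carrier P" "x \<succeq> y"
  shows "neg P y \<succeq> neg P x"
proof -
  have "neg P y \<oplus> x \<succeq> neg P y \<oplus> y"
    using assms by (intro add_mono2) (auto simp: bclosed ge_refl)
  then show ?thesis using assms by (simp add: ge_neg_iff neg_add_self ge_one_iff bclosed)
qed

lemma neg_dneg: "x \<in> carrier P \<Longrightarrow> neg P (dneg P x) = neg P x"
  using neg_antimono[of x "dneg P x"] ge_dneg[of x] ge_dneg[of "neg P x"]
  by (intro ge_antisym) (auto simp: bclosed dneg_def)

lemma dneg_dneg: "x \<in> carrier P \<Longrightarrow> dneg P (dneg P x) = dneg P x"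
  using neg_dneg by (simp add: dneg_def)

lemma dneg_mono:
  assumes "x \<in> carrier P" "y \<in> carrier P" "x \<succeq> y"
  shows "dneg P x \<succeq> dneg P y"
  using assms by (simp add: dneg_def neg_antimono bclosed)

lemma imp_neg_commute:
  assumes "x \<in> carrier P" "y \<in> carrier P"
  shows "x \<leadsto> neg P y = y \<leadsto> neg P x"
  using assms neg_add[of x y] neg_add[of y x] by (simp add: add_comm)

lemma dneg_imp_neg:
  assumes "x \<in> carrier P" "y \<in> carrier P"
  shows "dneg P x \<leadsto> neg P y = x \<leadsto> neg P y"
  using assms by (simp add: imp_neg_commute[of _ y] neg_dneg bclosed)

section \<open>Dense elements and compatibility of double negation with the operations\<close>

lemma absorb_of_imp_eq:
  assumes "d \<in> carrier P" "p \<in> carrier P" "d \<leadsto> p = p" "p \<succeq> d"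
  shows "d \<oplus> p = p"
  using add_imp_eq[of p d] assms by simp

text \<open>Contraposition gives \<open>d \<leadsto> \<not>x = x \<leadsto> \<not>d = x \<leadsto>
  \<one> = \<not>x\<close>.\<close>

lemma dense_absorb:
  assumes "d \<in> carrier P" "neg P d = \<one>" "x \<in> carrier P" "neg P x \<succeq> d"
  shows "d \<oplus> neg P x = neg P x"
proof (rule absorb_of_imp_eq)
  show "d \<leadsto> neg P x = neg P x"
    using assms imp_neg_commute[of d x] by (simp add: neg_def[of P x])
qed (use assms in \<open>auto simp: bclosed\<close>)

lemma dneg_imp_self_dense:
  assumes x: "x \<in> carrier P"
  shows "neg P (dneg P x \<leadsto> x) = \<one>"
proof -
  let ?d = "dneg P x \<leadsto> x" and ?n = "neg P x"
  note cl = x bclosed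
  have nd: "?n \<oplus> dneg P x = \<one>"
    using neg_add_self[of ?n] by (simp add: cl dneg_def add_comm)
  have n_ge: "?n \<succeq> ?d"
    by (simp add: cl residuation[symmetric] nd one_ge)
  have x_eq: "dneg P x \<oplus> ?d = x" using add_imp_eq[of x "dneg P x"] ge_dneg by (simp add: cl)
  \<comment> \<open>Negating the decomposition \<open>x_eq\<close> and then contraposing shows that
    \<open>?d \<leadsto> ?n = ?n\<close>, so \<open>?n\<close> absorbs \<open>?d\<close> before
    density is known.\<close>
  have n1: "dneg P x \<leadsto> neg P ?d = ?n" using neg_add[of "dneg P x" ?d] by (simp add: cl x_eq)
  have n2: "?d \<leadsto> ?n = ?n"
    using n1 imp_neg_commute[of ?d "dneg P x"] by (simp add: cl neg_dneg)
  have dn: "?d \<oplus> ?n = ?n" using n2 n_ge by (intro absorb_of_imp_eq) (auto simp: cl)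
  have "neg P ?d \<oplus> ?n = (neg P ?d \<oplus> ?d) \<oplus> ?n"
    by (subst add_assoc) (auto simp: cl dn)
  also have "\<dots> = \<one>" by (simp add: cl neg_add_self add_comm[of \<one>] add_one)
  finally have "neg P ?d \<succeq> dneg P x" by (simp add: cl dneg_def ge_neg_iff)
  \<comment> \<open>Divisibility splits \<open>\<not>d\<close> into
    \<open>\<not>\<not>x \<oplus> \<not>x\<close>, which is \<open>\<one>\<close>.\<close>
  then have "dneg P x \<oplus> (dneg P x \<leadsto> neg P ?d) = neg P ?d"
    by (intro add_imp_eq) (auto simp: cl)
  then show ?thesis using nd n1 by (simp add: cl add_comm)
qed

lemma dneg_imp:
  assumes x: "x \<in> carrier P" and y: "y \<in> carrier P"
  shows "dneg P (x \<leadsto> y) = dneg P x \<leadsto> dneg P y"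
proof (rule ge_antisym)
  note cl = x y bclosed
  let ?u = "dneg P x \<leadsto> dneg P y" and ?e = "dneg P y \<leadsto> y"
  have u: "?u = x \<leadsto> dneg P y"
    using dneg_imp_neg[of x "neg P y"] by (simp add: cl dneg_def[of P y])
  show "?u \<in> carrier P" "dneg P (x \<leadsto> y) \<in> carrier P" by (simp_all add: cl)
  \<comment> \<open>This direction is modus ponens, contraposed twice.\<close>
  have "((x \<leadsto> y) \<oplus> x) \<oplus> neg P y \<succeq> y \<oplus> neg P y"
    by (intro add_mono imp_elim) (simp_all add: cl)
  then have "((x \<leadsto> y) \<oplus> x) \<oplus> neg P y = \<one>"
    using neg_add_self[OF y] by (simp add: cl add_comm[of y] ge_one_iff)
  then have "(x \<oplus> neg P y) \<oplus> (x \<leadsto> y) = \<one>"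
    by (simp add: cl add_assoc[of "x \<leadsto> y" x] add_comm[of _ "x \<leadsto> y"])
  then have "x \<oplus> neg P y \<succeq> neg P (x \<leadsto> y)" by (simp add: cl ge_neg_iff)
  then have "neg P (neg P (x \<leadsto> y)) \<succeq> neg P (x \<oplus> neg P y)"
    by (intro neg_antimono) (simp_all add: cl)
  then show "dneg P (x \<leadsto> y) \<succeq> ?u"
    unfolding u by (simp add: cl neg_add dneg_def[symmetric])
  have "(?u \<oplus> x) \<oplus> ?e \<succeq> dneg P y \<oplus> ?e"
    unfolding u by (intro add_mono imp_elim) (simp_all add: cl)
  moreover have "dneg P y \<oplus> ?e = y"
    by (intro add_imp_eq ge_dneg) (simp_all add: cl)
  ultimately have "(?u \<oplus> ?e) \<oplus> x \<succeq> y"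
    by (simp add: cl add_assoc add_comm[of x])
  then have "?u \<oplus> ?e \<succeq> x \<leadsto> y" by (simp add: cl residuation)
  then have "neg P (x \<leadsto> y) \<succeq> neg P (?u \<oplus> ?e)" by (intro neg_antimono) (simp_all add: cl)
  \<comment> \<open>Negation discards the dense summand: \<open>\<not>(u \<oplus> e) = u \<leadsto>
    \<not>e = u \<leadsto> \<one>\<close>.\<close>
  also have "neg P (?u \<oplus> ?e) = neg P ?u"
    by (simp add: cl neg_add dneg_imp_self_dense neg_def[of P ?u])
  finally have "dneg P ?u \<succeq> dneg P (x \<leadsto> y)"
    using neg_antimono[of "neg P (x \<leadsto> y)" "neg P ?u"] by (simp add: cl dneg_def[symmetric])
  then show "?u \<succeq> dneg P (x \<leadsto> y)"
    using ge_trans[of ?u "dneg P ?u"] ge_dneg[of ?u] by (simp add: cl)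
qed

lemma dneg_add:
  assumes x: "x \<in> carrier P" and y: "y \<in> carrier P"
  shows "dneg P (x \<oplus> y) = dneg P x \<oplus> dneg P y"
proof -
  note cl = x y bclosed
  let ?p = "dneg P x" and ?q = "dneg P y"
  let ?r = "dneg P (?p \<oplus> ?q)"
  let ?d = "?r \<leadsto> (?p \<oplus> ?q)"
  \<comment> \<open>It remains to show that a sum of two double negations is fixed by double
    negation.\<close>
  have "neg P (?p \<oplus> ?q) = neg P (x \<oplus> y)"
    by (simp add: cl neg_add neg_dneg dneg_imp_neg)
  then have eq: "dneg P (x \<oplus> y) = ?r" by (simp add: dneg_def)
  have "?r \<succeq> ?p" "?r \<succeq> ?q"
    using dneg_mono[OF _ _ ge_add_left[of ?p ?q]] dneg_mono[OF _ _ ge_add_right[of ?p ?q]]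
    by (simp_all add: cl dneg_dneg)
  then have "?r \<oplus> ?r \<succeq> ?p \<oplus> ?q" by (intro add_mono2) (simp_all add: cl)
  then have "?r \<succeq> ?d" by (simp add: cl residuation)
  moreover have "neg P ?d = \<one>" by (intro dneg_imp_self_dense) (simp add: cl)
  \<comment> \<open>Absorption applies because \<open>?r\<close> is itself a negation.\<close>
  ultimately have "?d \<oplus> ?r = ?r"
    using dense_absorb[of ?d "neg P (?p \<oplus> ?q)"] by (simp add: cl dneg_def[of P "?p \<oplus> ?q"])
  moreover have "?r \<oplus> ?d = ?p \<oplus> ?q" by (intro add_imp_eq ge_dneg) (simp_all add: cl)
  ultimately show ?thesis using eq by (simp add: cl add_comm)
qed

section \<open>Kernel and image of double negation\<close>

lemma dneg_hom: "bounded_hoop_hom P P (dneg P)"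
  by unfold_locales (auto simp: bclosed dneg_add dneg_imp dneg_def[of P \<zero>] dneg_def[of P \<one>]
      neg_zero neg_one)

text \<open>The kernel is a competitor in the intersection, which gives one inclusion. Conversely,
  elements with equal double negations are both related to that common value.\<close>

lemma inv_cong_iff: "(x, y) \<in> inv_cong P \<longleftrightarrow>
  x \<in> carrier P \<and> y \<in> carrier P \<and> dneg P x = dneg P y"
proof
  let ?K = "{(x, y). x \<in> carrier P \<and> y \<in> carrier P \<and> dneg P x = dneg P y}"
  have "congruence P ?K"
    by (auto simp: congruence_def equiv_def refl_on_def sym_def trans_def bclosed dneg_add dneg_imp)
  then have "inv_cong P \<subseteq> ?K"
    by (rule inv_cong_smallest) (auto simp: bclosed dneg_dneg)
  then show "x \<in> carrier P \<and> y \<in> carrier P \<and> dneg P x = dneg P y" if "(x, y) \<in> inv_cong P"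
    using that by blast
next
  assume *: "x \<in> carrier P \<and> y \<in> carrier P \<and> dneg P x = dneg P y"
  have "sym (inv_cong P)" "trans (inv_cong P)"
    using inv_cong_smallest(1) by (auto simp: congruence_def equiv_def)
  moreover have "(x, dneg P x) \<in> inv_cong P" "(y, dneg P x) \<in> inv_cong P"
    using * inv_cong_smallest(2) by auto
  ultimately show "(x, y) \<in> inv_cong P" by (meson symD transD)
qed

text \<open>Since the order is defined by an equation, every axiom is inherited by a subset closed
  under the operations. This serves the image of double negation.\<close>

lemma bounded_hoop_subalgebra:
  assumes "S \<subseteq> carrier P" "\<zero> \<in> S" "\<one> \<in> S"
    and "\<And>x y. x \<in> S \<Longrightarrow> y \<in> S \<Longrightarrow> x \<oplus> y \<in> S"
    and "\<And>x y. x \<in> S \<Longrightarrow> y \<in> S \<Longrightarrow> x \<leadsto> y \<in> S"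
  shows "bounded_hoop (P\<lparr>carrier := S\<rparr>)"
proof -
  have ge: "x \<succeq>\<^bsub>P\<lparr>carrier := S\<rparr>\<^esub> y \<longleftrightarrow> x \<succeq> y" for x y by (simp add: pocrim_ge_def)
  have S: "x \<in> carrier P" if "x \<in> S" for x using assms that by blast
  show ?thesis
    by unfold_locales
      (simp_all add: assms S ge add_assoc add_zero ge_refl ge_zero add_mono residuation[symmetric] add_one,
        (blast intro: S add_comm divisibility ge_antisym | blast intro: S ge_trans)+)
qed

end

text \<open>The target is not assumed to be a bounded hoop: its axioms are transported along \<open>h\<close>.\<close>

lemma bounded_hoop_isoI:
  assumes "bounded_hoop A" and bij: "bij_betw h (carrier A) (carrier B)"
    and h0: "h \<zero>\<^bsub>A\<^esub> = \<zero>\<^bsub>B\<^esub>" and h1: "h \<one>\<^bsub>A\<^esub> = \<one>\<^bsub>B\<^esub>"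
    and add: "\<And>x y. x \<in> carrier A \<Longrightarrow> y \<in> carrier A \<Longrightarrow> h (x \<oplus>\<^bsub>A\<^esub> y) = h x \<oplus>\<^bsub>B\<^esub> h y"
    and imp: "\<And>x y. x \<in> carrier A \<Longrightarrow> y \<in> carrier A \<Longrightarrow> h (x \<leadsto>\<^bsub>A\<^esub> y) = h x \<leadsto>\<^bsub>B\<^esub> h y"
  shows "bounded_hoop_iso A B h"
proof -
  interpret A: bounded_hoop A by fact
  have B: "carrier B = h ` carrier A" using bij by (simp add: bij_betw_def)
  have inj: "h x = h y \<longleftrightarrow> x = y" if "x \<in> carrier A" "y \<in> carrier A" for x y
    using bij that by (auto simp: bij_betw_def inj_on_def)
  have ge: "h x \<succeq>\<^bsub>B\<^esub> h y \<longleftrightarrow> x \<succeq>\<^bsub>A\<^esub> y" if "x \<in> carrier A" "y \<in> carrier A" for x y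
    using that by (simp add: pocrim_ge_def imp[symmetric] h0[symmetric] inj A.bclosed)
  note tr = B inj ge A.bclosed add[symmetric] imp[symmetric] h0[symmetric] h1[symmetric]
  interpret B: bounded_hoop B
    by unfold_locales
      (auto simp: tr A.add_assoc A.add_zero A.ge_refl A.ge_zero A.add_mono A.residuation[symmetric]
          A.add_one,
        (blast intro: A.add_comm A.divisibility A.ge_antisym | blast intro: A.ge_trans)+)
  show ?thesis
    by unfold_locales (use bij in \<open>auto simp: h0 h1 add imp B\<close>)
qed

text \<open>Compatibility with \<open>\<theta>\<close> makes all classes in the union coincide, so
  operations on classes can be computed on representatives.\<close>

lemma quotient_pocrim_op:
  assumes "equiv C \<theta>" "x \<in> C" "y \<in> C"
    and "\<And>x x' y y'. (x, x') \<in> \<theta> \<Longrightarrow> (y, y') \<in> \<theta> \<Longrightarrow> (f x y, f x' y') \<in> \<theta>"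
  shows "(\<Union>x\<in>\<theta> `` {x}. \<Union>y\<in>\<theta> `` {y}. \<theta> `` {f x y}) = \<theta> `` {f x y}"
proof (rule UN_equiv_class2[OF assms(1,1) _ assms(2,3)])
  show "congruent2 \<theta> \<theta> (\<lambda>x y. \<theta> `` {f x y})"
    unfolding congruent2_def by (auto intro!: equiv_class_eq[OF assms(1)] assms(4))
qed

theorem theorem5p1p1:
  fixes H :: "'a bounded_pocrim"
  assumes "bounded_hoop H"
  shows "bounded_hoop_hom H H (dneg H) \<and>
    (\<exists>i. bounded_hoop_iso (dneg_image H) (IR H) i \<and>
      (\<forall>x\<in>carrier H. IR_proj H x = (i \<circ> dneg H) x))"
proof (intro conjI exI ballI)
  interpret bounded_hoop H by fact
  interpret \<delta>: bounded_hoop_hom H H "dneg H" by (rule dneg_hom)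
  let ?\<theta> = "inv_cong H"
  have equiv: "equiv (carrier H) ?\<theta>" and cong:
    "\<And>x x' y y'. (x, x') \<in> ?\<theta> \<Longrightarrow> (y, y') \<in> ?\<theta> \<Longrightarrow> (x \<oplus>\<^bsub>H\<^esub> y, x' \<oplus>\<^bsub>H\<^esub> y') \<in> ?\<theta>"
    "\<And>x x' y y'. (x, x') \<in> ?\<theta> \<Longrightarrow> (y, y') \<in> ?\<theta> \<Longrightarrow> (x \<leadsto>\<^bsub>H\<^esub> y, x' \<leadsto>\<^bsub>H\<^esub> y') \<in> ?\<theta>"
    using inv_cong_smallest(1) by (auto simp: congruence_def)
  have class_eq: "IR_proj H x = IR_proj H y \<longleftrightarrow> dneg H x = dneg H y"
    if "x \<in> carrier H" "y \<in> carrier H" for x y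
    using eq_equiv_class_iff[OF equiv that] that by (simp add: IR_proj_def inv_cong_iff)
  show "bounded_hoop_hom H H (dneg H)" by (rule dneg_hom)
  \<comment> \<open>The isomorphism is the projection itself, restricted to the image:
    \<open>x\<close> and \<open>\<not>\<not>x\<close> lie in the same class.\<close>
  show proj: "IR_proj H x = (IR_proj H \<circ> dneg H) x" if "x \<in> carrier H" for x
    using that by (simp add: class_eq bclosed dneg_dneg)
  show "bounded_hoop_iso (dneg_image H) (IR H) (IR_proj H)"
  proof (rule bounded_hoop_isoI)
    show "bounded_hoop (dneg_image H)"
      unfolding dneg_image_def
    proof (rule bounded_hoop_subalgebra)
      show "\<zero>\<^bsub>H\<^esub> \<in> dneg H ` carrier H" "\<one>\<^bsub>H\<^esub> \<in> dneg H ` carrier H"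
        using \<delta>.hom_zero \<delta>.hom_one by (metis bclosed imageI)+
    qed (auto simp: bclosed dneg_add[symmetric] dneg_imp[symmetric])
    have "carrier (IR H) = IR_proj H ` carrier H"
      by (auto simp: IR_def quotient_pocrim_def quotient_def IR_proj_def)
    also have "\<dots> = IR_proj H ` dneg H ` carrier H"
      unfolding image_image using proj by (intro image_cong) auto
    \<comment> \<open>Elements of the image are fixed by double negation, so those in the same class
      are equal.\<close>
    finally show "bij_betw (IR_proj H) (carrier (dneg_image H)) (carrier (IR H))"
      by (auto simp: bij_betw_def inj_on_def dneg_image_def class_eq bclosed dneg_dneg)
    fix x y
    assume "x \<in> carrier (dneg_image H)" "y \<in> carrier (dneg_image H)"
    then have xy: "x \<in> carrier H" "y \<in> carrier H" by (auto simp: dneg_image_def bclosed)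
    show "IR_proj H (x \<oplus>\<^bsub>dneg_image H\<^esub> y) = IR_proj H x \<oplus>\<^bsub>IR H\<^esub> IR_proj H y"
      "IR_proj H (x \<leadsto>\<^bsub>dneg_image H\<^esub> y) = IR_proj H x \<leadsto>\<^bsub>IR H\<^esub> IR_proj H y"
      using quotient_pocrim_op[OF equiv xy cong(1)] quotient_pocrim_op[OF equiv xy cong(2)]
      by (simp_all add: dneg_image_def IR_def quotient_pocrim_def IR_proj_def)
  qed (simp_all add: dneg_image_def IR_def quotient_pocrim_def IR_proj_def)
qed

end
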